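(* Let $X\in M_n(\mathbb{C})$ be unitarily irreducible and rotationally invariant, so that $\mathbb{C}^n=H_1\oplus\cdots\oplus H_k$ (orthogonal) with $X(H_1)=\{0\}$ and $X(H_i)\subseteq H_{i-1}$ for $2\le i\le k$. Let $\lambda_j$ be a simple eigenvalue of $H_X(\theta)$ (which, by rotational invariance, is an eigenvalue of $H_X(\theta)$ for every $\theta$, and is simple for every $\theta$), and let $y^{(j)}(\theta)$ be a unit eigenvector of $H_X(\theta)$ for $\lambda_j$ depending real-analytically on $\theta\in\mathbb{R}$. Then there exist nonnegative numbers $c_1^{(j)},\dots,c_k^{(j)}$ with $\sum_{m=1}^k c_m^{(j)}=1$, defining $p_j(z)=\sum_{m=1}^k c_m^{(j)}z^{m-1}$, and a real-analytic real-valued function $\psi$ such that $$\langle y^{(j)}(\theta),y^{(j)}(\phi)\rangle=p_j\bigl(e^{i(\phi-\theta)}\bigr)e^{i(\psi(\phi)-\psi(\theta))}\qquad(\theta,\phi\in\mathbb{R}).$$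
   Context: $X\in M_n$ is rotationally invariant if $X$ and $e^{i\theta}X$ are unitarily similar for every $\theta\in\mathbb{R}$. A unitarily irreducible matrix is one not unitarily similar to a direct sum of two smaller matrices; by a theorem of Li and Tsing, a unitarily irreducible matrix is rotationally invariant iff it is unitarily similar to a block shift, i.e. there is an orthogonal decomposition as in the claim. $H_X(\theta)=\operatorname{Re}(e^{-i\theta}X)=\frac12(e^{-i\theta}X+e^{i\theta}X^* )$. The inner product $\langle\cdot,\cdot\rangle$ is linear in the first argument. *)

theory Defs
  imports "Jordan_Normal_Form.Char_Poly" "Jordan_Normal_Form.Conjugate"
begin

definition adj :: "complex mat \<Rightarrow> complex mat" where
  "adj A = mat (dim_col A) (dim_row A) (\<lambda>(i,j). cnj (A $$ (j,i)))"

definition unitary_mat :: "nat \<Rightarrow> complex mat \<Rightarrow> bool" where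
  "unitary_mat n U \<longleftrightarrow> U \<in> carrier_mat n n \<and> U * adj U = 1\<^sub>m n \<and> adj U * U = 1\<^sub>m n"

definition unitarily_similar :: "nat \<Rightarrow> complex mat \<Rightarrow> complex mat \<Rightarrow> bool" where
  "unitarily_similar n A B \<longleftrightarrow> (\<exists>U. unitary_mat n U \<and> B = U * A * adj U)"

definition unitarily_irreducible :: "nat \<Rightarrow> complex mat \<Rightarrow> bool" where
  "unitarily_irreducible n X \<longleftrightarrow> X \<in> carrier_mat n n \<and>
     \<not> (\<exists>p q B C. 0 < p \<and> 0 < q \<and> p + q = n \<and> B \<in> carrier_mat p p \<and> C \<in> carrier_mat q q \<and>
          unitarily_similar n X (four_block_mat B (0\<^sub>m p q) (0\<^sub>m q p) C))"

definition rotationally_invariant :: "nat \<Rightarrow> complex mat \<Rightarrow> bool" where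
  "rotationally_invariant n X \<longleftrightarrow> X \<in> carrier_mat n n \<and>
     (\<forall>\<theta>::real. unitarily_similar n X (exp (\<i> * of_real \<theta>) \<cdot>\<^sub>m X))"

text \<open>H_X(theta) = Re(e^{-i theta} X) = (e^{-i theta} X + e^{i theta} X^*)/2.\<close>
definition HX :: "complex mat \<Rightarrow> real \<Rightarrow> complex mat" where
  "HX X \<theta> = (1/2 :: complex) \<cdot>\<^sub>m (exp (- \<i> * of_real \<theta>) \<cdot>\<^sub>m X + exp (\<i> * of_real \<theta>) \<cdot>\<^sub>m adj X)"

definition cinner :: "complex vec \<Rightarrow> complex vec \<Rightarrow> complex" where
  "cinner x y = (\<Sum>i<dim_vec x. x $ i * cnj (y $ i))"

definition is_subspace :: "nat \<Rightarrow> complex vec set \<Rightarrow> bool" where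
  "is_subspace n S \<longleftrightarrow> S \<subseteq> carrier_vec n \<and> 0\<^sub>v n \<in> S \<and>
     (\<forall>u\<in>S. \<forall>v\<in>S. u + v \<in> S) \<and> (\<forall>a. \<forall>v\<in>S. a \<cdot>\<^sub>v v \<in> S)"

definition orth_decomp :: "nat \<Rightarrow> nat \<Rightarrow> (nat \<Rightarrow> complex vec set) \<Rightarrow> bool" where
  "orth_decomp n k H \<longleftrightarrow>
     (\<forall>i\<in>{1..k}. is_subspace n (H i)) \<and>
     (\<forall>i\<in>{1..k}. \<forall>j\<in>{1..k}. i \<noteq> j \<longrightarrow> (\<forall>u\<in>H i. \<forall>v\<in>H j. cinner u v = 0)) \<and>
     (\<forall>v\<in>carrier_vec n. \<exists>h. (\<forall>i\<in>{1..k}. h i \<in> H i \<and> h i \<in> carrier_vec n) \<and>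
          v = finsum_vec TYPE(complex) n h {1..k})"

definition simple_eigenvalue :: "complex mat \<Rightarrow> complex \<Rightarrow> bool" where
  "simple_eigenvalue A l \<longleftrightarrow> eigenvalue A l \<and> order l (char_poly A) = 1"

definition real_analytic :: "(real \<Rightarrow> 'a::real_normed_vector) \<Rightarrow> bool" where
  "real_analytic f \<longleftrightarrow> (\<forall>x. \<exists>r>0. \<exists>a::nat \<Rightarrow> 'a.
     \<forall>t. \<bar>t - x\<bar> < r \<longrightarrow> (\<lambda>m. (t - x) ^ m *\<^sub>R a m) sums f t)"

definition real_analytic_vec :: "nat \<Rightarrow> (real \<Rightarrow> complex vec) \<Rightarrow> bool" where
  "real_analytic_vec n y \<longleftrightarrow> (\<forall>i<n. real_analytic (\<lambda>t. y t $ i))"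

end

theory Submission
  imports "HOL-Complex_Analysis.Complex_Analysis"
    "Jordan_Normal_Form.Jordan_Normal_Form_Uniqueness"
    "Jordan_Normal_Form.Jordan_Normal_Form_Existence"
    Defs
begin

text \<open>Multiplying the component in \<open>H\<^sub>m\<close> by \<open>e\<^sup>i\<^sup>m\<^sup>t\<close> defines a unitary \<open>U(t)\<close> with
  \<open>H\<^sub>X(\<theta> + t) U(t) = U(t) H\<^sub>X(\<theta>)\<close>, because \<open>X\<close> lowers the grading by one. As the eigenvalue is
  simple, \<open>y(\<theta>) = g(\<theta>) U(\<theta> - \<theta>\<^sub>0) y(\<theta>\<^sub>0)\<close> with \<open>g\<close> analytic and unimodular, so the inner products
  are \<open>g(\<theta>) cnj(g(\<phi>))\<close> times a sum over \<open>m\<close> of \<open>e\<^sup>i\<^sup>m\<^sup>(\<^sup>\<theta>\<^sup>-\<^sup>\<phi>\<^sup>)\<close> weighted by the squared norms of the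
  components of \<open>y(\<theta>\<^sub>0)\<close>. The exponents have the opposite sign to those of the claim, hence the
  weights are taken in reverse order and the resulting factor \<open>e\<^sup>i\<^sup>k\<^sup>(\<^sup>\<theta>\<^sup>-\<^sup>\<phi>\<^sup>)\<close> goes into the phase.\<close>

unbundle no vec_syntax
no_notation fps_nth (infixl \<open>$\<close> 75)

subsection \<open>Real-analytic functions\<close>

text \<open>A power series converging on a real interval also converges on the complex disc of the
  same radius; conversely the Taylor series of \<open>F\<close> restricts to the real axis. Products
  and logarithms can then be treated with holomorphic functions instead of coefficient
  manipulations.\<close>

lemma real_analytic_iff_holomorphic_extension:
  fixes f :: "real \<Rightarrow> complex"
  shows "real_analytic f \<longleftrightarrow> (\<forall>x. \<exists>r>0. \<exists>F. F holomorphic_on ball (of_real x) r \<and>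
           (\<forall>t. \<bar>t - x\<bar> < r \<longrightarrow> F (of_real t) = f t))" (is "_ \<longleftrightarrow> ?R")
proof
  assume f: "real_analytic f"
  show ?R
  proof
    fix x
    from f obtain r a where r: "r > 0"
      and a: "\<And>t. \<bar>t - x\<bar> < r \<Longrightarrow> (\<lambda>m. (t - x) ^ m *\<^sub>R a m) sums f t"
      unfolding real_analytic_def by blast
    define F where "F z = (\<Sum>m. a m * (z - of_real x) ^ m)" for z :: complex
    have sums: "(\<lambda>m. a m * (z - of_real x) ^ m) sums F z" if z: "z \<in> ball (of_real x) r" for z
    proof -
      \<comment> \<open>The real point \<open>x + s\<close> lies strictly between \<open>z\<close>
        and the boundary in distance from \<open>x\<close>. Convergence there forces convergence at
        \<open>z\<close>.\<close>
      define s where "s = (cmod (z - of_real x) + r) / 2"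
      have s: "cmod (z - of_real x) < s" "s < r" "0 \<le> s"
        using z r by (auto simp: s_def dist_norm norm_minus_commute)
      have "summable (\<lambda>m. (x + s - x) ^ m *\<^sub>R a m)"
        using a[of "x + s"] s by (intro sums_summable) auto
      then have "summable (\<lambda>m. a m * of_real s ^ m)"
        by (simp add: scaleR_conv_of_real mult.commute)
      from powser_inside[OF this] s show ?thesis
        unfolding F_def by (intro summable_sums) simp
    qed
    have "F holomorphic_on ball (of_real x) r"
      by (rule power_series_holomorphic[OF sums])
    moreover have "F (of_real t) = f t" if t: "\<bar>t - x\<bar> < r" for t
    proof -
      have "complex_of_real t \<in> ball (of_real x) r"
        using t by (simp add: dist_of_real dist_real_def abs_minus_commute)
      from sums[OF this] a[OF t] show ?thesis
        by (auto simp: scaleR_conv_of_real mult.commute intro: sums_unique2)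
    qed
    ultimately show "\<exists>r>0. \<exists>F. F holomorphic_on ball (of_real x) r \<and>
           (\<forall>t. \<bar>t - x\<bar> < r \<longrightarrow> F (of_real t) = f t)" using r by blast
  qed
next
  assume R: ?R
  show "real_analytic f" unfolding real_analytic_def
  proof
    fix x
    from R obtain r F where r: "r > 0" and hol: "F holomorphic_on ball (of_real x) r"
      and F: "\<And>t. \<bar>t - x\<bar> < r \<Longrightarrow> F (of_real t) = f t" by blast
    have "(\<lambda>m. (t - x) ^ m *\<^sub>R ((deriv ^^ m) F (of_real x) / fact m)) sums f t"
      if t: "\<bar>t - x\<bar> < r" for t
    proof -
      have "complex_of_real t \<in> ball (of_real x) r"
        using t by (simp add: dist_of_real dist_real_def abs_minus_commute)
      from holomorphic_power_series[OF hol this] F[OF t] show ?thesis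
        by (simp add: scaleR_conv_of_real mult.commute)
    qed
    then show "\<exists>r>0. \<exists>a. \<forall>t. \<bar>t - x\<bar> < r \<longrightarrow> (\<lambda>m. (t - x) ^ m *\<^sub>R a m) sums f t"
      using r by (intro exI[of _ r] conjI exI[of _ "\<lambda>m. (deriv ^^ m) F (of_real x) / fact m"]) auto
  qed
qed

lemma real_analytic_mult:
  fixes f g :: "real \<Rightarrow> complex"
  assumes "real_analytic f" "real_analytic g"
  shows "real_analytic (\<lambda>t. f t * g t)"
  unfolding real_analytic_iff_holomorphic_extension
proof
  fix x
  from assms obtain r F s G where "r > 0" "F holomorphic_on ball (of_real x) r"
      "\<And>t. \<bar>t - x\<bar> < r \<Longrightarrow> F (of_real t) = f t" 
      "s > 0" "G holomorphic_on ball (of_real x) s"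
      "\<And>t. \<bar>t - x\<bar> < s \<Longrightarrow> G (of_real t) = g t" 
    unfolding real_analytic_iff_holomorphic_extension by meson
  moreover from this have "(\<lambda>z. F z * G z) holomorphic_on ball (of_real x) (min r s)"
    by (intro holomorphic_intros; elim holomorphic_on_subset) auto
  ultimately show "\<exists>r>0. \<exists>F. F holomorphic_on ball (of_real x) r \<and>
           (\<forall>t. \<bar>t - x\<bar> < r \<longrightarrow> F (of_real t) = f t * g t)"
    by (intro exI[of _ "min r s"] conjI exI[of _ "\<lambda>z. F z * G z"]) auto
qed

lemma real_analytic_add:
  fixes f g :: "real \<Rightarrow> complex"
  assumes "real_analytic f" "real_analytic g"
  shows "real_analytic (\<lambda>t. f t + g t)"
  unfolding real_analytic_iff_holomorphic_extension
proof
  fix x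
  from assms obtain r F s G where "r > 0" "F holomorphic_on ball (of_real x) r"
      "\<And>t. \<bar>t - x\<bar> < r \<Longrightarrow> F (of_real t) = f t" 
      "s > 0" "G holomorphic_on ball (of_real x) s"
      "\<And>t. \<bar>t - x\<bar> < s \<Longrightarrow> G (of_real t) = g t" 
    unfolding real_analytic_iff_holomorphic_extension by meson
  moreover from this have "(\<lambda>z. F z + G z) holomorphic_on ball (of_real x) (min r s)"
    by (intro holomorphic_intros; elim holomorphic_on_subset) auto
  ultimately show "\<exists>r>0. \<exists>F. F holomorphic_on ball (of_real x) r \<and>
           (\<forall>t. \<bar>t - x\<bar> < r \<longrightarrow> F (of_real t) = f t + g t)"
    by (intro exI[of _ "min r s"] conjI exI[of _ "\<lambda>z. F z + G z"]) auto
qed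

lemma real_analytic_of_holomorphic:
  assumes "F holomorphic_on UNIV"
  shows "real_analytic (\<lambda>t. F (complex_of_real t))"
  unfolding real_analytic_iff_holomorphic_extension
proof
  fix x
  show "\<exists>r>0. \<exists>G. G holomorphic_on ball (of_real x) r \<and>
           (\<forall>t. \<bar>t - x\<bar> < r \<longrightarrow> G (of_real t) = F (of_real t))"
    using holomorphic_on_subset[OF assms] by (intro exI[of _ 1] conjI exI[of _ F]) auto
qed

lemma real_analytic_sum:
  fixes f :: "'i \<Rightarrow> real \<Rightarrow> complex"
  assumes "\<And>i. i \<in> I \<Longrightarrow> real_analytic (f i)"
  shows "real_analytic (\<lambda>t. \<Sum>i\<in>I. f i t)"
  using assms
proof (induction I rule: infinite_finite_induct)
  case (insert i I)
  then show ?case by (simp add: real_analytic_add)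
qed (simp_all add: real_analytic_of_holomorphic[where F = "\<lambda>_. 0"])

text \<open>The map is applied to the series term by term. Only real linearity enters, which covers
  \<open>cnj\<close> and \<open>Im\<close>; these are not holomorphic, so composing them with a
  holomorphic extension would fail.\<close>

lemma real_analytic_bounded_linear:
  assumes T: "bounded_linear T" and f: "real_analytic f"
  shows "real_analytic (\<lambda>t. T (f t))"
  unfolding real_analytic_def
proof
  fix x
  from f obtain r a where r: "r > 0"
    and a: "\<And>t. \<bar>t - x\<bar> < r \<Longrightarrow> (\<lambda>m. (t - x) ^ m *\<^sub>R a m) sums f t"
    unfolding real_analytic_def by blast
  interpret T: bounded_linear T by (rule T)
  have "(\<lambda>m. (t - x) ^ m *\<^sub>R T (a m)) sums T (f t)" if "\<bar>t - x\<bar> < r" for t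
    using T.sums[OF a[OF that]] by (simp add: T.scaleR)
  with r show "\<exists>r>0. \<exists>a. \<forall>t. \<bar>t - x\<bar> < r \<longrightarrow> (\<lambda>m. (t - x) ^ m *\<^sub>R a m) sums T (f t)"
    by (intro exI[of _ r] conjI exI[of _ "\<lambda>m. T (a m)"]) auto
qed

section \<open>Continuous logarithms and real phases of real-analytic functions\<close>

lemma real_analytic_imp_isCont:
  fixes f :: "real \<Rightarrow> complex"
  assumes "real_analytic f"
  shows "isCont f x"
proof -
  from assms obtain r F where r: "r > 0" and hol: "F holomorphic_on ball (of_real x) r"
    and F: "\<And>t. \<bar>t - x\<bar> < r \<Longrightarrow> F (of_real t) = f t"
    unfolding real_analytic_iff_holomorphic_extension by meson
  have "isCont F (of_real x)"
    using holomorphic_on_imp_continuous_on[OF hol] r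
    by (simp add: continuous_on_eq_continuous_at)
  then have "isCont (\<lambda>t. F (complex_of_real t)) x"
    by (rule isCont_o2[rotated]) (simp add: continuous_of_real)
  moreover have "\<forall>\<^sub>F t in nhds x. F (of_real t) = f t"
    unfolding eventually_nhds_metric using r F by (auto simp: dist_real_def)
  ultimately show ?thesis
    by (simp add: isCont_cong)
qed

text \<open>A continuous logarithm of a real-analytic function is locally a constant plus a branch of
  \<open>Ln\<close> of its holomorphic extension.\<close>

lemma real_analytic_continuous_log:
  fixes g L :: "real \<Rightarrow> complex"
  assumes g: "real_analytic g" and L: "continuous_on UNIV L" and gL: "\<And>t. g t = exp (L t)"
  shows "real_analytic L"
  unfolding real_analytic_iff_holomorphic_extension
proof
  fix x
  from g obtain r F where r: "r > 0" and hol: "F holomorphic_on ball (of_real x) r"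
    and F: "\<And>t. \<bar>t - x\<bar> < r \<Longrightarrow> F (of_real t) = g t"
    unfolding real_analytic_iff_holomorphic_extension by meson
  have gx: "g x \<noteq> 0" "F (of_real x) = g x" using gL F r by auto
  have "isCont F (of_real x)"
    using holomorphic_on_imp_continuous_on[OF hol] r
    by (simp add: continuous_on_eq_continuous_at)
  then have "isCont (\<lambda>z. F z / g x) (of_real x)"
    using gx by (intro continuous_intros) auto
  from this[unfolded continuous_at_eps_delta, rule_format, of 1]
  obtain d where d: "d > 0"
    and dF: "\<And>z. dist z (of_real x) < d \<Longrightarrow> dist (F z / g x) (F (of_real x) / g x) < 1"
    by auto
  \<comment> \<open>Dividing by \<open>g x\<close> places the argument of \<open>Ln\<close> within
    distance 1 of 1 on the ball of radius \<open>s\<close>, hence in the right half-plane and off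
    the branch cut. Adding \<open>L x\<close> makes \<open>K\<close> agree with \<open>L\<close> at
    \<open>x\<close>.\<close>
  define s where "s = min r d"
  define K where "K z = Ln (F z / g x) + L x" for z
  have s: "s > 0" "s \<le> r" "s \<le> d" using r d by (auto simp: s_def)
  have nonpos: "F z / g x \<notin> \<real>\<^sub>\<le>\<^sub>0" if "z \<in> ball (of_real x) s" for z
  proof -
    have "cmod (F z / g x - 1) < 1"
      using dF[of z] that s gx by (auto simp: dist_norm norm_minus_commute)
    then have "\<bar>Re (F z / g x - 1)\<bar> < 1"
      using abs_Re_le_cmod[of "F z / g x - 1"] by linarith
    then have "Re (F z / g x) > 0" by (simp add: abs_less_iff)
    then show ?thesis by (auto simp: complex_nonpos_Reals_iff simp del: Re_divide)
  qed
  have holK: "K holomorphic_on ball (of_real x) s"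
    unfolding K_def using s gx nonpos
    by (intro holomorphic_intros holomorphic_on_subset[OF hol]) auto
  have in_ball: "complex_of_real t \<in> ball (of_real x) s" if "t \<in> ball x s" for t
    using that by (simp add: dist_of_real)
  have expK: "exp (K (of_real t) - L t) = 1" if t: "t \<in> ball x s" for t
  proof -
    have "F (of_real t) = g t" 
      using t s by (intro F) (auto simp: dist_real_def)
    moreover have "exp (Ln (F (of_real t) / g x)) = F (of_real t) / g x"
      using nonpos[OF in_ball[OF t]] by (intro exp_Ln) auto
    ultimately show ?thesis
      using gx by (simp add: K_def exp_add exp_diff gL[symmetric]) (simp add: gL)
  qed
  \<comment> \<open>By \<open>expK\<close> the difference takes values in 2 pi i Z. Being continuous
    on an interval, it is constant; any gap below 2 pi separates its possible values, and 1 is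
    chosen.\<close>
  have "(\<lambda>t. K (of_real t) - L t) constant_on ball x s"
  proof (rule continuous_discrete_range_constant)
    have "continuous_on (ball x s) (\<lambda>t. K (of_real t))"
      by (rule continuous_on_compose2[OF holomorphic_on_imp_continuous_on[OF holK]])
         (use in_ball in \<open>auto intro: continuous_intros\<close>)
    then show "continuous_on (ball x s) (\<lambda>t. K (of_real t) - L t)"
      by (intro continuous_intros continuous_on_subset[OF L]) auto
    show "\<exists>e>0. \<forall>u. u \<in> ball x s \<and> K (of_real u) - L u \<noteq> K (of_real t) - L t \<longrightarrow>
            e \<le> cmod (K (of_real u) - L u - (K (of_real t) - L t))" if t: "t \<in> ball x s" for t
    proof (intro exI[of _ 1] conjI allI impI, simp, elim conjE)
      fix u
      assume u: "u \<in> ball x s" and ne: "K (of_real u) - L u \<noteq> K (of_real t) - L t"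
      show "1 \<le> cmod (K (of_real u) - L u - (K (of_real t) - L t))"
      proof (rule ccontr)
        assume "\<not> ?thesis"
        then have "\<bar>Im (K (of_real u) - L u) - Im (K (of_real t) - L t)\<bar> < 1"
          using abs_Im_le_cmod[of "K (of_real u) - L u - (K (of_real t) - L t)"] by simp
        also have "1 < 2 * pi" using pi_gt3 by simp
        finally have "K (of_real u) - L u = K (of_real t) - L t"
          by (rule exp_complex_eqI) (simp only: expK[OF t] expK[OF u])
        with ne show False ..
      qed
    qed
  qed simp
  then have "K (of_real t) - L t = K (of_real x) - L x" if "t \<in> ball x s" for t
    using that s unfolding constant_on_def by (metis centre_in_ball)
  then have "K (of_real t) = L t" if "\<bar>t - x\<bar> < s" for t
    using that gx by (simp add: K_def dist_real_def abs_minus_commute)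
  with s holK show "\<exists>r>0. \<exists>F. F holomorphic_on ball (of_real x) r \<and>
           (\<forall>t. \<bar>t - x\<bar> < r \<longrightarrow> F (of_real t) = L t)" by blast
qed

text \<open>Since the real line is contractible, \<open>g\<close> has a continuous logarithm
  \<open>L\<close>, which is real-analytic by the previous lemma. Unit modulus makes
  \<open>L\<close> purely imaginary, so \<psi> is its imaginary part.\<close>

lemma real_analytic_unimodular_lift:
  assumes g: "real_analytic g" and unit: "\<And>t. cmod (g t) = 1"
  obtains \<psi> where "real_analytic \<psi>" "\<And>t. g t = exp (\<i> * of_real (\<psi> t))"
proof -
  have "continuous_on UNIV g"
    using real_analytic_imp_isCont[OF g] by (simp add: continuous_on_eq_continuous_at)
  moreover have "g t \<noteq> 0" for t using unit[of t] by auto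
  moreover have "contractible (UNIV :: real set)" by (simp add: convex_imp_contractible)
  ultimately obtain L where L: "continuous_on UNIV L" and gL: "\<And>t. g t = exp (L t)"
    by (metis UNIV_I continuous_logarithm_on_contractible)
  have "L t = \<i> * of_real (Im (L t))" for t
    using unit[of t] unfolding gL norm_exp_eq_Re by (simp add: complex_eq_iff)
  with gL have "g t = exp (\<i> * of_real (Im (L t)))" for t by metis
  with that[OF real_analytic_bounded_linear[OF bounded_linear_Im real_analytic_continuous_log[OF g L gL]]] show thesis .
qed

subsection \<open>Simple eigenvalues\<close>

text \<open>A Jordan block of size \<open>n\<close> contributes \<open>min k n\<close> to the
  dimension of the generalised eigenspace of order \<open>k\<close>, so this bounds that dimension
  by the algebraic multiplicity.\<close>

lemma sum_list_min_le: "(\<Sum>n\<leftarrow>xs. min k n) \<le> sum_list (xs :: nat list)"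
  by (induction xs) auto

text \<open>Simplicity is given through the characteristic polynomial. The Jordan form converts it
  into a bound on the eigenspace: geometric multiplicity is at most algebraic multiplicity, which is
  1.\<close>

lemma simple_eigenvalue_eigenvectors_proportional:
  assumes car: "A \<in> carrier_mat n n" and simple: "simple_eigenvalue A l"
    and v: "eigenvector A v l" and w: "w \<in> carrier_vec n" "A *\<^sub>v w = l \<cdot>\<^sub>v w"
  obtains a where "w = a \<cdot>\<^sub>v v"
proof -
  have vc: "v \<in> carrier_vec n" "v \<noteq> 0\<^sub>v n" "A *\<^sub>v v = l \<cdot>\<^sub>v v" using v car by (auto simp: eigenvector_def)
  let ?C = "char_matrix A l"
  have C: "?C \<in> carrier_mat n n" using car by simp
  interpret kernel n n ?C by unfold_locales (rule C)
  obtain as where "char_poly A = (\<Prod>a\<leftarrow>as. [:- a, 1:])"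
    using char_poly_factorized[OF car] by auto
  then obtain n_as where jnf: "jordan_nf A n_as"
    using jordan_nf_exists[OF car] by blast
  have "kernel_dim ?C = dim_gen_eigenspace A l 1"
    using C by (simp add: dim_gen_eigenspace_def)
  also have "\<dots> \<le> sum_list (map fst [(n, e)\<leftarrow>n_as . e = l])"
    unfolding dim_gen_eigenspace[OF jnf] by (rule sum_list_min_le)
  also have "[(n, e)\<leftarrow>n_as . e = l] = filter (\<lambda>na. snd na = l) n_as"
    by (rule filter_cong) auto
  also have "sum_list (map fst \<dots>) = 1"
    using simple unfolding simple_eigenvalue_def jordan_nf_order[OF jnf] by simp
  finally have dim: "dim \<le> 1" unfolding kernel_dim .
  obtain B where B: "finite B" "basis B" using kernel_basis_exists[OF C] by blast
  have Bsub: "B \<subseteq> mat_kernel ?C" and Bspan: "span B = mat_kernel ?C"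
    using B by (auto simp: Ker.basis_def)
  have "card B \<le> 1" using Ker.dim_basis[OF B] dim by simp
  then obtain b where b: "B \<subseteq> {b}"
    using B(1) by (metis card_le_Suc0_iff_eq One_nat_def insertI1 subsetI)
  \<comment> \<open>Stated by coordinates because \<open>b\<close> is arbitrary when
    \<open>B\<close> is empty and then need not have dimension \<open>n\<close>.\<close>
  have multiple: "\<exists>a. \<forall>i<n. u $ i = a * b $ i" if "u \<in> mat_kernel ?C" for u
  proof -
    have "u \<in> span B" using that Bspan by simp
    then obtain U c where U: "U \<subseteq> B" "u = lincomb c U"
      unfolding LinearCombinations.module.span_def[OF Ker.module_axioms] by auto
    have "u $ i = (\<Sum>x\<in>U. c x * x $ i)" if "i < n" for i
      unfolding U(2) using lincomb_index[OF that] U(1) Bsub by auto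
    moreover have "U = {} \<or> U = {b}" using U(1) b by auto
    ultimately show ?thesis by (cases "U = {}") (auto intro: exI[of _ 0])
  qed
  have ker: "u \<in> mat_kernel ?C" if "eigenvector A u l" for u
    using that C unfolding eigenvector_char_matrix[OF car] by (auto intro: mat_kernelI)
  show thesis
  proof (cases "w = 0\<^sub>v n")
    case True
    then show ?thesis using that[of 0] vc by auto
  next
    case False
    then have "eigenvector A w l" using w car by (auto simp: eigenvector_def)
    from multiple[OF ker[OF this]] multiple[OF ker[OF v]] obtain \<alpha> \<beta>
      where \<alpha>: "\<And>i. i < n \<Longrightarrow> w $ i = \<alpha> * b $ i"
        and \<beta>: "\<And>i. i < n \<Longrightarrow> v $ i = \<beta> * b $ i" by auto
    have "\<beta> \<noteq> 0"
    proof
      assume "\<beta> = 0"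
      then have "v = 0\<^sub>v n" using vc \<beta> by (intro eq_vecI) auto
      with vc show False by simp
    qed
    then have "w = (\<alpha> / \<beta>) \<cdot>\<^sub>v v" using vc w \<alpha> \<beta> by (intro eq_vecI) auto
    then show ?thesis by (rule that)
  qed
qed

subsection \<open>Block shifts\<close>

lemma cinner_eq_sum: "x \<in> carrier_vec n \<Longrightarrow> cinner x y = (\<Sum>i<n. x $ i * cnj (y $ i))"
  by (auto simp: cinner_def)

lemma cinner_smult_left: "cinner (a \<cdot>\<^sub>v x) y = a * cinner x y"
  by (simp add: cinner_def sum_distrib_left mult.assoc)

lemma cinner_add_left:
  assumes "x \<in> carrier_vec n" "y \<in> carrier_vec n"
  shows "cinner (x + y) u = cinner x u + cinner y u"
  using assms by (simp add: cinner_def sum.distrib distrib_right)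

lemma cinner_smult_right:
  assumes "x \<in> carrier_vec n" "y \<in> carrier_vec n"
  shows "cinner x (a \<cdot>\<^sub>v y) = cnj a * cinner x y"
  using assms by (simp add: cinner_eq_sum sum_distrib_left mult.left_commute)

lemma cinner_self: "cinner x x = of_real (\<Sum>i<dim_vec x. (cmod (x $ i))\<^sup>2)"
  by (simp only: cinner_def complex_norm_square of_real_sum)

lemma cinner_zero_left: "cinner (0\<^sub>v n) y = 0"
  by (simp add: cinner_def)

lemma cinner_zero_right: "x \<in> carrier_vec n \<Longrightarrow> cinner x (0\<^sub>v n) = 0"
  by (simp add: cinner_def)

lemma cinner_adj:
  assumes "X \<in> carrier_mat n n" "u \<in> carrier_vec n" "v \<in> carrier_vec n"
  shows "cinner (adj X *\<^sub>v u) v = cinner u (X *\<^sub>v v)"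
proof -
  have adj: "adj X *\<^sub>v u \<in> carrier_vec n" using assms(1) by (simp add: adj_def carrier_vecI)
  have "cinner (adj X *\<^sub>v u) v = (\<Sum>i<n. \<Sum>j<n. cnj (X $$ (j,i)) * u $ j * cnj (v $ i))"
    unfolding cinner_eq_sum[OF adj]
  proof (intro sum.cong refl)
    fix i assume "i \<in> {..<n}"
    then have "(adj X *\<^sub>v u) $ i = (\<Sum>j<n. cnj (X $$ (j,i)) * u $ j)"
      using assms by (simp add: adj_def scalar_prod_def lessThan_atLeast0)
    then show "(adj X *\<^sub>v u) $ i * cnj (v $ i) = (\<Sum>j<n. cnj (X $$ (j,i)) * u $ j * cnj (v $ i))"
      by (simp add: sum_distrib_right)
  qed
  also have "\<dots> = (\<Sum>j<n. \<Sum>i<n. cnj (X $$ (j,i)) * u $ j * cnj (v $ i))"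
    by (rule sum.swap)
  also have "\<dots> = cinner u (X *\<^sub>v v)"
    unfolding cinner_eq_sum[OF assms(2)]
  proof (intro sum.cong refl)
    fix j assume "j \<in> {..<n}"
    then have "(X *\<^sub>v v) $ j = (\<Sum>i<n. X $$ (j,i) * v $ i)"
      using assms by (simp add: scalar_prod_def lessThan_atLeast0)
    then show "(\<Sum>i<n. cnj (X $$ (j,i)) * u $ j * cnj (v $ i)) = u $ j * cnj ((X *\<^sub>v v) $ j)"
      by (simp add: sum_distrib_left mult.left_commute mult.assoc)
  qed
  finally show ?thesis .
qed

lemma smult_mat_mult_vec: "dim_vec v = dim_col A \<Longrightarrow> (c \<cdot>\<^sub>m A) *\<^sub>v v = c \<cdot>\<^sub>v (A *\<^sub>v v :: complex vec)"
  by (intro eq_vecI) auto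

lemma HX_carrier: "X \<in> carrier_mat n n \<Longrightarrow> HX X \<theta> \<in> carrier_mat n n"
  by (auto simp: HX_def adj_def)

text \<open>The adjoint is moved to the second argument, so that only the action of \<open>X\<close>
  on the graded pieces has to be known.\<close>

lemma cinner_HX:
  assumes X: "X \<in> carrier_mat n n" and w: "w \<in> carrier_vec n" and u: "u \<in> carrier_vec n"
  shows "cinner (HX X \<theta> *\<^sub>v w) u =
    (exp (- \<i> * of_real \<theta>) * cinner (X *\<^sub>v w) u + exp (\<i> * of_real \<theta>) * cinner w (X *\<^sub>v u)) / 2"
proof -
  have adj: "adj X \<in> carrier_mat n n" using X by (auto simp: adj_def)
  have HX: "HX X \<theta> *\<^sub>v w = (1/2) \<cdot>\<^sub>v (exp (- \<i> * of_real \<theta>) \<cdot>\<^sub>v (X *\<^sub>v w)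
      + exp (\<i> * of_real \<theta>) \<cdot>\<^sub>v (adj X *\<^sub>v w))"
    unfolding HX_def using X adj w
    by (simp add: smult_mat_mult_vec add_mult_distrib_mat_vec[of _ n n])
  have "cinner (HX X \<theta> *\<^sub>v w) u = (exp (- \<i> * of_real \<theta>) * cinner (X *\<^sub>v w) u
      + exp (\<i> * of_real \<theta>) * cinner (adj X *\<^sub>v w) u) / 2"
    unfolding HX cinner_smult_left
    by (subst cinner_add_left[of _ n]) (use X adj w in \<open>simp_all add: cinner_smult_left\<close>)
  then show ?thesis by (simp only: cinner_adj[OF X w u])
qed

text \<open>Here \<open>h m\<close> is meant as the component of a vector in \<open>H m\<close>. All
  weights 1 give back the vector; the weights e^(imt) give its image under the unitary
  \<open>U(t)\<close>. This makes \<open>U(t)\<close> available without constructing it as a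
  matrix.\<close>

definition graded_comb :: "nat \<Rightarrow> nat \<Rightarrow> (nat \<Rightarrow> complex) \<Rightarrow> (nat \<Rightarrow> complex vec) \<Rightarrow> complex vec" where
  "graded_comb n k a h = vec n (\<lambda>i. \<Sum>m=1..k. a m * h m $ i)"

lemma graded_comb_carrier [simp]: "graded_comb n k a h \<in> carrier_vec n"
  by (simp add: graded_comb_def)

lemma cinner_graded_comb_left:
  assumes "\<forall>m\<in>{1..k}. h m \<in> carrier_vec n"
  shows "cinner (graded_comb n k a h) u = (\<Sum>m=1..k. a m * cinner (h m) u)"
proof -
  have "cinner (graded_comb n k a h) u = (\<Sum>i<n. \<Sum>m=1..k. a m * h m $ i * cnj (u $ i))"
    by (simp add: cinner_def graded_comb_def sum_distrib_right)
  also have "\<dots> = (\<Sum>m=1..k. \<Sum>i<n. a m * h m $ i * cnj (u $ i))"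
    by (rule sum.swap)
  also have "\<dots> = (\<Sum>m=1..k. a m * cinner (h m) u)"
    by (intro sum.cong refl) (use assms in \<open>simp add: cinner_eq_sum[of _ n] sum_distrib_left mult.assoc\<close>)
  finally show ?thesis .
qed

lemma cinner_graded_comb_right:
  assumes "\<forall>m\<in>{1..k}. h m \<in> carrier_vec n" "u \<in> carrier_vec n"
  shows "cinner u (graded_comb n k a h) = (\<Sum>m=1..k. cnj (a m) * cinner u (h m))"
proof -
  have "cinner u (graded_comb n k a h) = (\<Sum>i<n. \<Sum>m=1..k. u $ i * (cnj (a m) * cnj (h m $ i)))"
    using assms(2) by (simp add: cinner_eq_sum graded_comb_def sum_distrib_left)
  also have "\<dots> = (\<Sum>m=1..k. \<Sum>i<n. u $ i * (cnj (a m) * cnj (h m $ i)))"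
    by (rule sum.swap)
  also have "\<dots> = (\<Sum>m=1..k. cnj (a m) * cinner u (h m))"
    by (intro sum.cong refl)
       (use assms in \<open>simp add: cinner_eq_sum[of _ n] sum_distrib_left mult.left_commute\<close>)
  finally show ?thesis .
qed

lemma mult_mat_vec_graded_comb:
  assumes "X \<in> carrier_mat n n" "\<forall>m\<in>{1..k}. h m \<in> carrier_vec n"
  shows "X *\<^sub>v graded_comb n k a h = graded_comb n k a (\<lambda>m. X *\<^sub>v h m)"
proof (rule eq_vecI)
  fix i assume "i < dim_vec (graded_comb n k a (\<lambda>m. X *\<^sub>v h m))"
  then have i: "i < n" by (simp add: graded_comb_def)
  have "(X *\<^sub>v graded_comb n k a h) $ i = (\<Sum>j<n. \<Sum>m=1..k. X $$ (i,j) * (a m * h m $ j))"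
    using assms i
    by (simp add: graded_comb_def scalar_prod_def sum_distrib_left lessThan_atLeast0)
  also have "\<dots> = (\<Sum>m=1..k. \<Sum>j<n. X $$ (i,j) * (a m * h m $ j))"
    by (rule sum.swap)
  also have "\<dots> = (\<Sum>m=1..k. a m * (X *\<^sub>v h m) $ i)"
  proof (intro sum.cong refl)
    fix m assume "m \<in> {1..k}"
    then have "h m \<in> carrier_vec n" using assms(2) by blast
    then show "(\<Sum>j<n. X $$ (i,j) * (a m * h m $ j)) = a m * (X *\<^sub>v h m) $ i"
      using assms(1) i
      by (simp add: scalar_prod_def sum_distrib_left lessThan_atLeast0 mult.left_commute)
  qed
  finally show "(X *\<^sub>v graded_comb n k a h) $ i = graded_comb n k a (\<lambda>m. X *\<^sub>v h m) $ i"
    using i by (simp add: graded_comb_def)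
qed (use assms in \<open>simp add: graded_comb_def\<close>)

section \<open>Graded components and the twisting of eigenvectors\<close>

locale block_shift =
  fixes n k :: nat and X :: "complex mat" and H :: "nat \<Rightarrow> complex vec set"
  assumes X: "X \<in> carrier_mat n n"
    and dec: "orth_decomp n k H"
    and H1: "\<And>v. v \<in> H 1 \<Longrightarrow> X *\<^sub>v v = 0\<^sub>v n"
    and Hi: "\<And>i v. \<lbrakk>i \<in> {2..k}; v \<in> H i\<rbrakk> \<Longrightarrow> X *\<^sub>v v \<in> H (i - 1)"
begin

lemma H_carrier: "m \<in> {1..k} \<Longrightarrow> u \<in> H m \<Longrightarrow> u \<in> carrier_vec n"
  using dec unfolding orth_decomp_def is_subspace_def by blast

lemma H_orth: "\<lbrakk>i \<in> {1..k}; j \<in> {1..k}; i \<noteq> j; u \<in> H i; v \<in> H j\<rbrakk> \<Longrightarrow> cinner u v = 0"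
  using dec unfolding orth_decomp_def by blast

lemma graded_comb_exists:
  assumes v: "v \<in> carrier_vec n"
  shows "\<exists>h. (\<forall>m\<in>{1..k}. h m \<in> H m) \<and> v = graded_comb n k (\<lambda>_. 1) h"
proof -
  from dec v obtain h where h: "\<forall>i\<in>{1..k}. h i \<in> H i \<and> h i \<in> carrier_vec n"
      and vh: "v = finsum_vec TYPE(complex) n h {1..k}"
    unfolding orth_decomp_def by blast
  have "v = graded_comb n k (\<lambda>_. 1) h"
  proof (rule eq_vecI)
    fix i assume "i < dim_vec (graded_comb n k (\<lambda>_. 1) h)"
    then have i: "i < n" by (simp add: graded_comb_def)
    have "v $ i = (\<Sum>m=1..k. h m $ i)"
      unfolding vh using h i by (intro index_finsum_vec) auto
    then show "v $ i = graded_comb n k (\<lambda>_. 1) h $ i"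
      using i by (simp add: graded_comb_def)
  qed (use v in \<open>simp add: graded_comb_def\<close>)
  with h show ?thesis by blast
qed

lemma cinner_graded_comb_component:
  assumes h: "\<forall>m\<in>{1..k}. h m \<in> H m" and j: "j \<in> {1..k}" and u: "u \<in> H j"
  shows "cinner (graded_comb n k a h) u = a j * cinner (h j) u"
proof -
  have "cinner (graded_comb n k a h) u = (\<Sum>m=1..k. a m * cinner (h m) u)"
    using h H_carrier by (intro cinner_graded_comb_left) blast
  also have "\<dots> = (\<Sum>m\<in>{j}. a m * cinner (h m) u)"
    using j u h by (intro sum.mono_neutral_right) (auto intro!: H_orth[of _ j])
  finally show ?thesis by simp
qed

text \<open>Every unit vector is a sum of elements of the \<open>H j\<close>, so testing against
  these subspaces determines all coordinates.\<close>

lemma eq_if_components_eq: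
  assumes x: "x \<in> carrier_vec n" and y: "y \<in> carrier_vec n"
    and eq: "\<And>j u. j \<in> {1..k} \<Longrightarrow> u \<in> H j \<Longrightarrow> cinner x u = cinner y u"
  shows "x = y"
proof (rule eq_vecI)
  fix i assume "i < dim_vec y"
  then have i: "i < n" using y by simp
  obtain h where h: "\<forall>m\<in>{1..k}. h m \<in> H m"
      and e: "unit_vec n i = graded_comb n k (\<lambda>_. 1) h"
    using graded_comb_exists[of "unit_vec n i"] by (metis unit_vec_carrier)
  have hc: "\<forall>m\<in>{1..k}. h m \<in> carrier_vec n" using h H_carrier by blast
  have comp: "cinner z (unit_vec n i) = z $ i" if "z \<in> carrier_vec n" for z
    using that i by (simp add: cinner_eq_sum if_distrib[of cnj] if_distrib[of "(*) _"] sum.delta' cong: if_cong)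
  have "cinner x (unit_vec n i) = cinner y (unit_vec n i)"
    unfolding e cinner_graded_comb_right[OF hc x] cinner_graded_comb_right[OF hc y]
    using eq h by (intro sum.cong refl) simp
  then show "x $ i = y $ i" using comp x y by simp
qed (use x y in simp)

text \<open>As \<open>X\<close> lowers the grading by one, only \<open>h (j + 1)\<close> contributes
  to the component in \<open>H j\<close>. For \<open>j = k\<close> no such index exists and both
  sides vanish, whatever the value of \<open>a (k + 1)\<close>.\<close>

lemma cinner_X_graded_comb:
  assumes h: "\<forall>m\<in>{1..k}. h m \<in> H m" and j: "j \<in> {1..k}" and u: "u \<in> H j"
  shows "cinner (X *\<^sub>v graded_comb n k a h) u
       = a (j + 1) * cinner (X *\<^sub>v graded_comb n k (\<lambda>_. 1) h) u"
proof -
  have hc: "\<forall>m\<in>{1..k}. h m \<in> carrier_vec n" using h H_carrier by blast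
  have Xc: "\<forall>m\<in>{1..k}. X *\<^sub>v h m \<in> carrier_vec n" using hc X by auto
  have "a m * cinner (X *\<^sub>v h m) u = a (j + 1) * (1 * cinner (X *\<^sub>v h m) u)" if m: "m \<in> {1..k}" for m
  proof (cases "m = j + 1")
    case False
    have "cinner (X *\<^sub>v h m) u = 0"
    proof (cases "m = 1")
      case True
      then show ?thesis using H1[of "h m"] bspec[OF h m] by (simp add: cinner_zero_left)
    next
      case ne: False
      then have "X *\<^sub>v h m \<in> H (m - 1)" using Hi[of m "h m"] bspec[OF h m] m by auto
      then show ?thesis using m ne False j u by (intro H_orth[of "m - 1" j]) auto
    qed
    then show ?thesis by simp
  qed simp
  then show ?thesis
    unfolding mult_mat_vec_graded_comb[OF X hc] cinner_graded_comb_left[OF Xc] sum_distrib_left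
    by (rule sum.cong[OF refl])
qed

text \<open>The vector \<open>X *\<^sub>v u\<close> lies in \<open>H (j - 1)\<close> and sees only
  the weight there. For \<open>j = 1\<close> it is zero, so the value \<open>a 0\<close> is
  harmless.\<close>

lemma cinner_graded_comb_X:
  assumes h: "\<forall>m\<in>{1..k}. h m \<in> H m" and j: "j \<in> {1..k}" and u: "u \<in> H j"
  shows "cinner (graded_comb n k a h) (X *\<^sub>v u)
       = a (j - 1) * cinner (graded_comb n k (\<lambda>_. 1) h) (X *\<^sub>v u)"
proof (cases "j = 1")
  case True
  then show ?thesis using H1[of u] u by (simp add: cinner_zero_right[OF graded_comb_carrier])
next
  case False
  then have "X *\<^sub>v u \<in> H (j - 1)" "j - 1 \<in> {1..k}" using Hi[of j u] j u by auto
  then show ?thesis using cinner_graded_comb_component[OF h, of "j - 1"] by simp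
qed

text \<open>This is \<open>H\<^sub>X(\<theta> + t) U(t) = U(t) H\<^sub>X(\<theta>)\<close> applied
  to an eigenvector and tested on each \<open>H j\<close>. The shift of the weight index by +1 or -1
  cancels the extra rotation by \<open>t\<close> in the two halves of \<open>HX\<close>, leaving the
  common factor \<open>a t j\<close>.\<close>

lemma HX_eigenvector_twist:
  assumes h: "\<forall>m\<in>{1..k}. h m \<in> H m"
    and eig: "HX X \<theta> *\<^sub>v graded_comb n k (\<lambda>_. 1) h = l \<cdot>\<^sub>v graded_comb n k (\<lambda>_. 1) h"
  defines "a \<equiv> \<lambda>t m. exp (\<i> * of_real (real m * t))"
  shows "HX X (\<theta> + t) *\<^sub>v graded_comb n k (a t) h = l \<cdot>\<^sub>v graded_comb n k (a t) h"
proof (rule eq_if_components_eq)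
  let ?v = "graded_comb n k (\<lambda>_. 1) h" and ?w = "graded_comb n k (a t) h"
  show "HX X (\<theta> + t) *\<^sub>v ?w \<in> carrier_vec n" 
    by (rule mult_mat_vec_carrier[OF HX_carrier[OF X] graded_comb_carrier])
  fix j u assume j: "j \<in> {1..k}" and u: "u \<in> H j"
  have uc: "u \<in> carrier_vec n" using H_carrier j u by blast
  have e1: "exp (- \<i> * of_real (\<theta> + t)) * a t (j + 1) = a t j * exp (- \<i> * of_real \<theta>)"
    by (simp add: a_def exp_add[symmetric] algebra_simps)
  \<comment> \<open>The bound 1 \<le> \<open>j\<close> makes the natural subtraction
    \<open>j - 1\<close> a genuine one.\<close>
  have e2: "exp (\<i> * of_real (\<theta> + t)) * a t (j - 1) = a t j * exp (\<i> * of_real \<theta>)"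
    using j by (simp add: a_def exp_add[symmetric] algebra_simps of_nat_diff)
  have "cinner (HX X (\<theta> + t) *\<^sub>v ?w) u
      = (exp (- \<i> * of_real (\<theta> + t)) * a t (j + 1) * cinner (X *\<^sub>v ?v) u
         + exp (\<i> * of_real (\<theta> + t)) * a t (j - 1) * cinner ?v (X *\<^sub>v u)) / 2"
    unfolding cinner_HX[OF X graded_comb_carrier uc] cinner_X_graded_comb[OF h j u, of "a t"]
      cinner_graded_comb_X[OF h j u, of "a t"] mult.assoc ..
  also have "\<dots> = a t j * cinner (HX X \<theta> *\<^sub>v ?v) u"
    unfolding e1 e2 cinner_HX[OF X graded_comb_carrier uc] by (simp add: algebra_simps)
  also have "\<dots> = cinner (l \<cdot>\<^sub>v ?w) u"
    unfolding eig cinner_smult_left cinner_graded_comb_component[OF h j u] by simp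
  finally show "cinner (HX X (\<theta> + t) *\<^sub>v ?w) u = cinner (l \<cdot>\<^sub>v ?w) u" .
qed simp

end

section \<open>Inner products along the curve of eigenvectors\<close>

theorem mainTheorem15:
  fixes n k :: nat and X :: "complex mat" and H :: "nat \<Rightarrow> complex vec set"
    and l :: complex and \<theta>\<^sub>0 :: real and y :: "real \<Rightarrow> complex vec"
  assumes X: "X \<in> carrier_mat n n"
    and irr: "unitarily_irreducible n X"
    and rot: "rotationally_invariant n X"
    and k: "1 \<le> k"
    and dec: "orth_decomp n k H"
    and H1: "\<forall>v\<in>H 1. X *\<^sub>v v = 0\<^sub>v n"
    and Hi: "\<forall>i\<in>{2..k}. \<forall>v\<in>H i. X *\<^sub>v v \<in> H (i - 1)"
    and simple: "simple_eigenvalue (HX X \<theta>\<^sub>0) l"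
    and ycar: "\<forall>\<theta>. y \<theta> \<in> carrier_vec n"
    and yunit: "\<forall>\<theta>. cinner (y \<theta>) (y \<theta>) = 1"
    and yeig: "\<forall>\<theta>. HX X \<theta> *\<^sub>v y \<theta> = l \<cdot>\<^sub>v y \<theta>"
    and yan: "real_analytic_vec n y"
  shows "\<exists>c :: nat \<Rightarrow> real. (\<forall>m\<in>{1..k}. 0 \<le> c m) \<and> (\<Sum>m=1..k. c m) = 1 \<and>
           (\<exists>\<psi> :: real \<Rightarrow> real. real_analytic \<psi> \<and>
              (\<forall>\<theta> \<phi>. cinner (y \<theta>) (y \<phi>) =
                 (\<Sum>m=1..k. of_real (c m) * exp (\<i> * of_real (\<phi> - \<theta>)) ^ (m - 1))
                 * exp (\<i> * of_real (\<psi> \<phi> - \<psi> \<theta>))))"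
proof -
  interpret bs: block_shift n k X H
    using X dec H1 Hi by unfold_locales auto
  define e :: "real \<Rightarrow> nat \<Rightarrow> complex" where "e = (\<lambda>t m. exp (\<i> * of_real (real m * t)))"
  obtain h where h: "\<forall>m\<in>{1..k}. h m \<in> H m" and yh: "y \<theta>\<^sub>0 = graded_comb n k (\<lambda>_. 1) h"
    using bs.graded_comb_exists ycar by metis
  have hc: "\<forall>m\<in>{1..k}. h m \<in> carrier_vec n" using h bs.H_carrier by blast
  \<comment> \<open>This is \<open>U(\<theta> - \<theta>\<^sub>0) y(\<theta>\<^sub>0)\<close>, the
    reference curve with which \<open>y\<close> is compared.\<close>
  define w where "w \<theta> = graded_comb n k (e (\<theta> - \<theta>\<^sub>0)) h" for \<theta>
  have wc: "w \<theta> \<in> carrier_vec n" for \<theta> by (simp add: w_def)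
  have ev: "eigenvector (HX X \<theta>\<^sub>0) (y \<theta>\<^sub>0) l"
    unfolding eigenvector_def using ycar yeig yunit HX_carrier[OF X, of \<theta>\<^sub>0]
    by (metis carrier_matD(1) cinner_zero_left zero_neq_one)
  \<comment> \<open>Simplicity is given at \<open>\<theta>\<^sub>0\<close>. So
    \<open>y \<theta>\<close> is carried back to \<open>\<theta>\<^sub>0\<close> by the twist,
    giving \<open>z\<close>, compared there with \<open>y \<theta>\<^sub>0\<close>, and the twist is
    then undone on each component.\<close>
  have "\<exists>a. y \<theta> = a \<cdot>\<^sub>v w \<theta>" for \<theta>
  proof -
    obtain g where g: "\<forall>m\<in>{1..k}. g m \<in> H m" and yg: "y \<theta> = graded_comb n k (\<lambda>_. 1) g"
      using bs.graded_comb_exists ycar by metis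
    define z where "z = graded_comb n k (e (\<theta>\<^sub>0 - \<theta>)) g"
    have "HX X (\<theta> + (\<theta>\<^sub>0 - \<theta>)) *\<^sub>v z = l \<cdot>\<^sub>v z"
      unfolding z_def e_def using yeig by (intro bs.HX_eigenvector_twist[OF g]) (simp flip: yg)
    then have "HX X \<theta>\<^sub>0 *\<^sub>v z = l \<cdot>\<^sub>v z" by simp
    then obtain a where a: "z = a \<cdot>\<^sub>v y \<theta>\<^sub>0"
      using simple_eigenvalue_eigenvectors_proportional[OF HX_carrier[OF X] simple ev, of z]
      by (auto simp: z_def)
    have "y \<theta> = a \<cdot>\<^sub>v w \<theta>"
    proof (rule bs.eq_if_components_eq)
      fix j u assume j: "j \<in> {1..k}" and u: "u \<in> H j"
      have "e (\<theta>\<^sub>0 - \<theta>) j * cinner (g j) u = a * cinner (h j) u"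
        using arg_cong[OF a, of "\<lambda>v. cinner v u"] unfolding yh z_def cinner_smult_left
          bs.cinner_graded_comb_component[OF g j u] bs.cinner_graded_comb_component[OF h j u]
        by simp
      moreover have "e (\<theta> - \<theta>\<^sub>0) j * e (\<theta>\<^sub>0 - \<theta>) j = 1"
        by (simp add: e_def exp_add[symmetric] algebra_simps)
      ultimately have "cinner (g j) u = a * (e (\<theta> - \<theta>\<^sub>0) j * cinner (h j) u)"
        by (metis mult.assoc mult.left_commute mult_1)
      then show "cinner (y \<theta>) u = cinner (a \<cdot>\<^sub>v w \<theta>) u"
        unfolding yg w_def cinner_smult_left bs.cinner_graded_comb_component[OF g j u]
          bs.cinner_graded_comb_component[OF h j u] by simp
    qed (use ycar wc in auto)
    then show ?thesis ..
  qed
  then obtain g where yw: "\<And>\<theta>. y \<theta> = g \<theta> \<cdot>\<^sub>v w \<theta>" by metis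
  \<comment> \<open>The squared norms of the components of \<open>y \<theta>\<^sub>0\<close>; in
    reverse order they become the coefficients of the polynomial.\<close>
  define N where "N m = (\<Sum>i<dim_vec (h m). (cmod (h m $ i))\<^sup>2)" for m
  have hN: "cinner (h m) (h m) = of_real (N m)" for m
    unfolding N_def by (rule cinner_self)
  have ww: "cinner (w \<theta>) (w \<phi>) = (\<Sum>m=1..k. e (\<theta> - \<phi>) m * of_real (N m))" for \<theta> \<phi>
  proof -
    have "cinner (w \<theta>) (w \<phi>) = (\<Sum>m=1..k. cnj (e (\<phi> - \<theta>\<^sub>0) m) * cinner (w \<theta>) (h m))"
      unfolding w_def[of \<phi>] by (rule cinner_graded_comb_right[OF hc wc])
    also have "\<dots> = (\<Sum>m=1..k. e (\<theta> - \<phi>) m * of_real (N m))"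
    proof (rule sum.cong[OF refl])
      fix m assume m: "m \<in> {1..k}"
      have "cinner (w \<theta>) (h m) = e (\<theta> - \<theta>\<^sub>0) m * of_real (N m)"
        unfolding w_def bs.cinner_graded_comb_component[OF h m bspec[OF h m]] hN ..
      moreover have "cnj (e (\<phi> - \<theta>\<^sub>0) m) * e (\<theta> - \<theta>\<^sub>0) m = e (\<theta> - \<phi>) m"
        by (simp add: e_def exp_cnj exp_add[symmetric] algebra_simps)
      ultimately show "cnj (e (\<phi> - \<theta>\<^sub>0) m) * cinner (w \<theta>) (h m) = e (\<theta> - \<phi>) m * of_real (N m)"
        by (simp flip: mult.assoc)
    qed
    finally show ?thesis .
  qed
  have yy: "cinner (y \<theta>) (y \<phi>) = g \<theta> * cnj (g \<phi>) * (\<Sum>m=1..k. e (\<theta> - \<phi>) m * of_real (N m))" for \<theta> \<phi>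
    unfolding yw cinner_smult_left cinner_smult_right[OF wc wc] ww by simp
  have "w \<theta>\<^sub>0 = y \<theta>\<^sub>0" unfolding w_def yh e_def by simp
  then have "complex_of_real (\<Sum>m=1..k. N m) = 1"
    using ww[of \<theta>\<^sub>0 \<theta>\<^sub>0] yunit by (simp add: e_def)
  then have sumN: "(\<Sum>m=1..k. N m) = 1"
    using of_real_eq_1_iff by blast
  then have ww1: "cinner (w \<theta>) (w \<theta>) = 1" for \<theta>
    unfolding ww by (simp add: e_def flip: of_real_sum)
  have g_unit: "cmod (g \<theta>) = 1" for \<theta>
  proof -
    have "g \<theta> * cnj (g \<theta>) = 1"
      using yunit unfolding yw cinner_smult_left cinner_smult_right[OF wc wc] ww1 by simp
    then have "(cmod (g \<theta>))\<^sup>2 = 1"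
      by (metis complex_norm_square of_real_eq_1_iff)
    then show ?thesis by (simp add: power2_eq_1_iff) (use norm_ge_zero[of "g \<theta>"] in linarith)
  qed
  \<comment> \<open>The factor \<open>g\<close> was merely chosen pointwise. Since
    \<open>w \<theta>\<close> is a unit vector, \<open>g\<close> is an inner product with it and
    inherits analyticity from \<open>y\<close> and \<open>w\<close>.\<close>
  have g_eq: "g \<theta> = (\<Sum>i<n. y \<theta> $ i * cnj (w \<theta> $ i))" for \<theta>
  proof -
    have "g \<theta> = cinner (y \<theta>) (w \<theta>)" unfolding yw cinner_smult_left ww1 by simp
    then show ?thesis using ycar by (simp add: cinner_eq_sum)
  qed
  have w_an: "real_analytic (\<lambda>\<theta>. w \<theta> $ i)" if "i < n" for i
  proof -
    have "(\<lambda>z. \<Sum>m=1..k. exp (\<i> * (of_nat m * (z - of_real \<theta>\<^sub>0))) * h m $ i) holomorphic_on UNIV"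
      by (intro holomorphic_intros)
    from real_analytic_of_holomorphic[OF this] show ?thesis
      using that by (simp add: w_def graded_comb_def e_def)
  qed
  have g_an: "real_analytic g"
    unfolding g_eq[abs_def] using yan w_an unfolding real_analytic_vec_def
    by (intro real_analytic_sum real_analytic_mult real_analytic_bounded_linear[OF bounded_linear_cnj]) auto
  \<comment> \<open>The conjugate is needed because \<phi> carries the positive sign in the claimed
    phase, while \<phi> enters the inner product through \<open>cnj (g \<phi>)\<close>. The
    exponential absorbs the factor left by reversing the weights.\<close>
  define G where "G t = cnj (g t * exp (\<i> * (of_nat k * of_real t)))" for t :: real
  have "(\<lambda>z. exp (\<i> * (of_nat k * z))) holomorphic_on UNIV"
    by (intro holomorphic_intros)
  then have "real_analytic G"
    unfolding G_def
    by (intro real_analytic_bounded_linear[OF bounded_linear_cnj] real_analytic_mult g_an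
        real_analytic_of_holomorphic)
  moreover have "cmod (G t) = 1" for t
    by (simp add: G_def norm_mult g_unit norm_exp_eq_Re)
  ultimately obtain \<psi> where \<psi>: "real_analytic \<psi>" and G\<psi>: "\<And>t. G t = exp (\<i> * of_real (\<psi> t))"
    using real_analytic_unimodular_lift by blast
  have "cinner (y \<theta>) (y \<phi>) =
      (\<Sum>m=1..k. of_real (N (k + 1 - m)) * exp (\<i> * of_real (\<phi> - \<theta>)) ^ (m - 1))
      * exp (\<i> * of_real (\<psi> \<phi> - \<psi> \<theta>))" for \<theta> \<phi>
  proof -
    have "exp (\<i> * of_real (\<psi> \<phi> - \<psi> \<theta>)) = G \<phi> * cnj (G \<theta>)"
      unfolding G\<psi> by (simp add: exp_cnj exp_add[symmetric] algebra_simps)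
    also have "\<dots> = g \<theta> * cnj (g \<phi>) * exp (\<i> * (of_nat k * of_real (\<theta> - \<phi>)))"
      unfolding G_def by (simp add: exp_cnj exp_add[symmetric] algebra_simps)
    finally have 1: "exp (\<i> * of_real (\<psi> \<phi> - \<psi> \<theta>))
        = g \<theta> * cnj (g \<phi>) * exp (\<i> * (of_nat k * of_real (\<theta> - \<phi>)))" .
    \<comment> \<open>The reversal \<open>m\<close> to \<open>k + 1 - m\<close> turns the exponent
      \<open>m - 1\<close> into \<open>k - m\<close>. Multiplying by e^(ik(\<theta> - \<phi>))
      cancels the \<open>k\<close> and leaves e^(im(\<theta> - \<phi>)), the exponent found in
      \<open>ww\<close>.\<close>
    have "(\<Sum>m=1..k. of_real (N (k + 1 - m)) * exp (\<i> * of_real (\<phi> - \<theta>)) ^ (m - 1))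
        = (\<Sum>m=1..k. of_real (N m) * exp (\<i> * of_real (\<phi> - \<theta>)) ^ (k - m))"
      by (rule sum.reindex_bij_witness[of _ "\<lambda>m. k + 1 - m" "\<lambda>m. k + 1 - m"]) auto
    also have "\<dots> * exp (\<i> * (of_nat k * of_real (\<theta> - \<phi>)))
        = (\<Sum>m=1..k. e (\<theta> - \<phi>) m * of_real (N m))"
      unfolding sum_distrib_right
    proof (rule sum.cong[OF refl])
      fix m assume m: "m \<in> {1..k}"
      have "exp (\<i> * of_real (\<phi> - \<theta>)) ^ (k - m) * exp (\<i> * (of_nat k * of_real (\<theta> - \<phi>))) = e (\<theta> - \<phi>) m"
        using m unfolding e_def exp_of_nat_mult[symmetric] exp_add[symmetric]
        by (simp add: of_nat_diff algebra_simps)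
      then show "of_real (N m) * exp (\<i> * of_real (\<phi> - \<theta>)) ^ (k - m) * exp (\<i> * (of_nat k * of_real (\<theta> - \<phi>)))
          = e (\<theta> - \<phi>) m * of_real (N m)"
        by (simp only: mult.assoc) (simp only: mult.commute)
    qed
    finally have 2: "(\<Sum>m=1..k. of_real (N (k + 1 - m)) * exp (\<i> * of_real (\<phi> - \<theta>)) ^ (m - 1))
        * exp (\<i> * (of_nat k * of_real (\<theta> - \<phi>))) = (\<Sum>m=1..k. e (\<theta> - \<phi>) m * of_real (N m))" .
    show ?thesis unfolding yy 1 2[symmetric] by (simp only: mult_ac)
  qed
  moreover have "(\<Sum>m=1..k. N (k + 1 - m)) = (\<Sum>m=1..k. N m)"
    by (rule sum.reindex_bij_witness[of _ "\<lambda>m. k + 1 - m" "\<lambda>m. k + 1 - m"]) auto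
  moreover have "0 \<le> N m" for m
    unfolding N_def by (intro sum_nonneg) simp
  ultimately show ?thesis
    using \<psi> sumN by (intro exI[of _ "\<lambda>m. N (k + 1 - m)"] conjI exI[of _ \<psi>]) auto
qed

end
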